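(* Let $t,s\in\mathrm{PT}_\Omega$ be trees, let $k+1$ be the number of nodes on the rightmost branch of $t$ and $l+1$ the number of nodes on the leftmost branch of $s$. If $\Omega$ is a set, then $$t\mathbin{\mathrm{sh}^T}s=\sum_{\sigma\in\mathrm{Sh}(k+1,l+1)}\sigma(t,s).$$ If $(\Omega,+)$ is a semigroup, then $$t\mathbin{\mathrm{qsh}^T}s=\sum_{\sigma\in\mathrm{QSh}(k+1,l+1)}\sigma(t,s).$$
   Context: $\mathbb K$ is a fixed field. A planar rooted tree is a finite rooted tree in which the children of every vertex are linearly ordered from left to right. $\mathrm{PT}_\Omega$ is the set of non-empty planar rooted trees with vertices decorated by $\Omega$, and $\mathcal{PT}_\Omega$ the $\mathbb K$-vector space with basis $\mathrm{PT}_\Omega$. A planar forest is a finite (possibly empty) ordered sequence of planar trees. $B_+^x(T_1\cdots T_k)$ is the tree obtained by grafting $T_1,\dots,T_k$ in this order on a new root decorated by $x$ (extended multilinearly); $B_+^x(\emptyset)$ is the one-vertex tree. Tree products. For $S=B_+^x(S_1\cdots S_k)$, $T=B_+^y(T_1\cdots T_\ell)$ with $k,\ell\ge0$, and with $\ast$ standing for $\mathrm{sh}^T$ (resp. $\mathrm{qsh}^T$), define by induction on the total number of vertices and bilinearity $S<T:=B_+^x(S_1\cdots S_{k-1}(S_k\ast T))$ if $k\ge1$ and $B_+^x(T)$ if $k=0$; $S>T:=B_+^y((S\ast T_1)T_2\cdots T_\ell)$ if $\ell\ge1$ and $B_+^y(S)$ if $\ell=0$; and, in the semigroup case, $S\bullet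 T:=B_+^{x+y}(S_1\cdots S_{k-1}(S_k\ast T_1)T_2\cdots T_\ell)$ if $k,\ell\ge1$, $B_+^{x+y}(T_1\cdots T_\ell)$ if $k=0$, $B_+^{x+y}(S_1\cdots S_k)$ if $\ell=0$. For $\Omega$ a set, $\mathrm{sh}^T:={<}+{>}$ (with $\ast=\mathrm{sh}^T$). For $(\Omega,+)$ a semigroup, $\mathrm{qsh}^T:={<}+{>}+\bullet$ (with $\ast=\mathrm{qsh}^T$). Combs. The rightmost (resp. leftmost) branch of a tree is the path starting at the root and going at each step to the last (resp. first) child, until a leaf. For $t$, let the nodes of its rightmost branch, from root to leaf, be decorated by $\omega_1,\dots,\omega_{k+1}$ and let $F_i$ ($1\le i\le k$) be the forest of subtrees attached to the $i$-th node other than the one containing the next node of the branch; $F_{k+1}=\emptyset$. For $s$, let the nodes of its leftmost branch, from root to leaf, be decorated by $\omega_{k+2},\dots,\omega_{k+l+2}$ and let $F_{k+1+j}$ ($1\le j\le l$) be the forest of subtrees attached to the $j$-th node other than the one containing the next node of the branch; $F_{k+l+2}=\emptyset$. Quasi-shuffles. For $p,q\ge1$, a $(p,q)$-quasi-shuffle is a surjection $\sigma:\{1,\dots,p+q\}\to\{1,\dots,n\}$, for some $n\ge 1$, with $\sigma(1)<\dots<\sigma(p)$ and $\sigma(p+1)<\dots<\sigma(p+q)$; their set is $\mathrm{QSh}(p,q)$, and $\mathrm{Sh}(p,q)$ is the subset of bijective ones ($(p,q)$-shuffles). The tree $\sigma(t,s)$, for $\sigma\in\mathrm{QSh}(k+1,l+1)$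 with image $\{1,\dots,n\}$: take the ladder with nodes $1,\dots,n$ (node $1$ the root, node $j+1$ a child of node $j$); for $1\le i\le k+1$ graft the forest $F_i$ on node $\sigma(i)$, to the left of the ladder; for $k+2\le i\le k+l+2$ graft $F_i$ on node $\sigma(i)$, to the right of the ladder; decorate node $j$ by $\omega_i$ if $\sigma^{-1}(\{j\})=\{i\}$, and by $\omega_i+\omega_r$ if $\sigma^{-1}(\{j\})=\{i,r\}$ with $i\le k+1<r$. For shuffles, only the first case occurs and $\Omega$ need only be a set. *)

theory Defs
  imports Main "HOL-Library.Poly_Mapping" "HOL-Library.FuncSet"
begin

text \<open>
  The decoration set is a type; the vector space with basis the planar rooted trees is the
  type of finitely supported functions from trees to the field.
\<close>

datatype 'a ptree = Node 'a "'a ptree list"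

type_synonym ('a, 'k) ptree_space = "'a ptree \<Rightarrow>\<^sub>0 'k"

definition basis :: "'b \<Rightarrow> ('b \<Rightarrow>\<^sub>0 'k::field)"
  where "basis b = Poly_Mapping.single b 1"

definition lin_ext :: "('b \<Rightarrow> ('c \<Rightarrow>\<^sub>0 'k)) \<Rightarrow> ('b \<Rightarrow>\<^sub>0 'k) \<Rightarrow> ('c \<Rightarrow>\<^sub>0 'k::field)"
  where "lin_ext f v =
    (\<Sum>b \<in> Poly_Mapping.keys v. Poly_Mapping.map ((*) (Poly_Mapping.lookup v b)) (f b))"

definition bilin_ext ::
    "('b \<Rightarrow> 'c \<Rightarrow> ('d \<Rightarrow>\<^sub>0 'k)) \<Rightarrow> ('b \<Rightarrow>\<^sub>0 'k) \<Rightarrow> ('c \<Rightarrow>\<^sub>0 'k) \<Rightarrow> ('d \<Rightarrow>\<^sub>0 'k::field)"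
  where "bilin_ext f u v = lin_ext (\<lambda>b. lin_ext (f b) v) u"

text \<open>
  The three half-products of two basis trees, relative to a product \<open>star\<close> of basis trees.
  A value of \<open>star\<close> is a linear combination \<open>\<Sum> c\<^sub>U U\<close>, put into a forest
  at a single position \<open>U\<close>; \<open>lin_ext\<close> extends the grafting linearly in that position.
\<close>

definition tree_prec ::
    "('a ptree \<Rightarrow> 'a ptree \<Rightarrow> ('a, 'k) ptree_space) \<Rightarrow> 'a ptree \<Rightarrow> 'a ptree
      \<Rightarrow> ('a, 'k::field) ptree_space"
  where "tree_prec star S T = (case S of Node x Ss \<Rightarrow>
    if Ss = [] then basis (Node x [T])
    else lin_ext (\<lambda>U. basis (Node x (butlast Ss @ [U]))) (star (last Ss) T))"

definition tree_succ ::
    "('a ptree \<Rightarrow> 'a ptree \<Rightarrow> ('a, 'k) ptree_space) \<Rightarrow> 'a ptree \<Rightarrow> 'a ptree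
      \<Rightarrow> ('a, 'k::field) ptree_space"
  where "tree_succ star S T = (case T of Node y Ts \<Rightarrow>
    if Ts = [] then basis (Node y [S])
    else lin_ext (\<lambda>U. basis (Node y (U # tl Ts))) (star S (hd Ts)))"

definition tree_bullet ::
    "('a \<Rightarrow> 'a \<Rightarrow> 'a) \<Rightarrow> ('a ptree \<Rightarrow> 'a ptree \<Rightarrow> ('a, 'k) ptree_space) \<Rightarrow> 'a ptree \<Rightarrow> 'a ptree
      \<Rightarrow> ('a, 'k::field) ptree_space"
  where "tree_bullet add star S T = (case S of Node x Ss \<Rightarrow> case T of Node y Ts \<Rightarrow>
    if Ss = [] then basis (Node (add x y) Ts)
    else if Ts = [] then basis (Node (add x y) Ss)
    else lin_ext (\<lambda>U. basis (Node (add x y) (butlast Ss @ [U] @ tl Ts)))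
           (star (last Ss) (hd Ts)))"

lemma tree_prec_cong [fundef_cong]:
  assumes "S = S'" "T = T'"
    and "\<And>x Ss. S' = Node x Ss \<Longrightarrow> Ss \<noteq> [] \<Longrightarrow> star (last Ss) T' = star' (last Ss) T'"
  shows "tree_prec star S T = tree_prec star' S' T'"
  using assms by (auto simp: tree_prec_def split: ptree.split)

lemma tree_succ_cong [fundef_cong]:
  assumes "S = S'" "T = T'"
    and "\<And>y Ts. T' = Node y Ts \<Longrightarrow> Ts \<noteq> [] \<Longrightarrow> star S' (hd Ts) = star' S' (hd Ts)"
  shows "tree_succ star S T = tree_succ star' S' T'"
  using assms by (auto simp: tree_succ_def split: ptree.split)

lemma tree_bullet_cong [fundef_cong]:
  assumes "add = add'" "S = S'" "T = T'"
    and "\<And>x Ss y Ts. S' = Node x Ss \<Longrightarrow> T' = Node y Ts \<Longrightarrow> Ss \<noteq> [] \<Longrightarrow> Ts \<noteq> []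
           \<Longrightarrow> star (last Ss) (hd Ts) = star' (last Ss) (hd Ts)"
  shows "tree_bullet add star S T = tree_bullet add' star' S' T'"
  using assms by (auto simp: tree_bullet_def split: ptree.split)

lemma size_last_less [termination_simp]: "Ss \<noteq> [] \<Longrightarrow> size (last Ss) < Suc (size_list size Ss)"
  using size_list_estimation'[of "last Ss" Ss "size (last Ss)" size] by (simp add: less_Suc_eq_le)

lemma size_hd_less [termination_simp]: "Ts \<noteq> [] \<Longrightarrow> size (hd Ts) < Suc (size_list size Ts)"
  using size_list_estimation'[of "hd Ts" Ts "size (hd Ts)" size] by (simp add: less_Suc_eq_le)

function sh_basis :: "'a ptree \<Rightarrow> 'a ptree \<Rightarrow> ('a, 'k::field) ptree_space"
  where "sh_basis S T = tree_prec sh_basis S T + tree_succ sh_basis S T"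
  by auto
termination
  by (relation "measure (\<lambda>(S, T). size S + size T)")
     (auto simp: size_last_less size_hd_less)

function qsh_basis ::
    "('a \<Rightarrow> 'a \<Rightarrow> 'a) \<Rightarrow> 'a ptree \<Rightarrow> 'a ptree \<Rightarrow> ('a, 'k::field) ptree_space"
  where "qsh_basis add S T =
    tree_prec (qsh_basis add) S T + tree_succ (qsh_basis add) S T
      + tree_bullet add (qsh_basis add) S T"
  by auto
termination
  by (relation "measure (\<lambda>(add, S, T). size S + size T)")
     (auto simp: size_last_less size_hd_less add_less_mono[OF size_last_less size_hd_less, simplified])

declare sh_basis.simps [simp del] qsh_basis.simps [simp del]

definition shT ::
    "('a, 'k) ptree_space \<Rightarrow> ('a, 'k) ptree_space \<Rightarrow> ('a, 'k::field) ptree_space"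
  where "shT = bilin_ext sh_basis"

definition qshT ::
    "('a \<Rightarrow> 'a \<Rightarrow> 'a) \<Rightarrow> ('a, 'k) ptree_space \<Rightarrow> ('a, 'k) ptree_space
      \<Rightarrow> ('a, 'k::field) ptree_space"
  where "qshT add = bilin_ext (qsh_basis add)"

text \<open>
  The nodes of the rightmost (leftmost) branch from root to leaf, each with its decoration and
  the forest of the subtrees that do not contain the next node of the branch (empty at the leaf).
\<close>

fun right_branch :: "'a ptree \<Rightarrow> ('a \<times> 'a ptree list) list"
  where "right_branch (Node x Ts) =
    (x, butlast Ts) # (if Ts = [] then [] else right_branch (last Ts))"

fun left_branch :: "'a ptree \<Rightarrow> ('a \<times> 'a ptree list) list"
  where "left_branch (Node x Ts) =
    (x, tl Ts) # (if Ts = [] then [] else left_branch (hd Ts))"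

definition branch_dec :: "'a ptree \<Rightarrow> 'a ptree \<Rightarrow> nat \<Rightarrow> 'a"
  where "branch_dec t s i = fst ((right_branch t @ left_branch s) ! (i - 1))"

definition branch_forest :: "'a ptree \<Rightarrow> 'a ptree \<Rightarrow> nat \<Rightarrow> 'a ptree list"
  where "branch_forest t s i = snd ((right_branch t @ left_branch s) ! (i - 1))"

text \<open>
  Membership in \<open>extensional\<close> fixes the values outside \<open>{1..p + q}\<close>, so that every
  quasi-shuffle is represented by exactly one function. The codomain is determined by surjectivity.
\<close>

definition QSh :: "nat \<Rightarrow> nat \<Rightarrow> (nat \<Rightarrow> nat) set"
  where "QSh p q = {\<sigma> \<in> extensional {1..p + q}.
    (\<exists>n\<ge>1. \<sigma> ` {1..p + q} = {1..n}) \<and>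
    strict_mono_on {1..p} \<sigma> \<and> strict_mono_on {p + 1..p + q} \<sigma>}"

definition Sh :: "nat \<Rightarrow> nat \<Rightarrow> (nat \<Rightarrow> nat) set"
  where "Sh p q = {\<sigma> \<in> QSh p q. \<exists>n. bij_betw \<sigma> {1..p + q} {1..n}}"

text \<open>
  \<open>ladder d L R j m\<close> is the ladder with nodes \<open>j, \<dots>, j + m\<close>, node \<open>i\<close> being decorated by
  \<open>d i\<close> and carrying the forests \<open>L i\<close> and \<open>R i\<close> to the left and right of the ladder.
\<close>

fun ladder ::
    "(nat \<Rightarrow> 'a) \<Rightarrow> (nat \<Rightarrow> 'a ptree list) \<Rightarrow> (nat \<Rightarrow> 'a ptree list) \<Rightarrow> nat \<Rightarrow> nat \<Rightarrow> 'a ptree"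
  where
    "ladder d L R j 0 = Node (d j) (L j @ R j)"
  | "ladder d L R j (Suc m) = Node (d j) (L j @ [ladder d L R (Suc j) m] @ R j)"

text \<open>
  The tree \<open>\<sigma>(t,s)\<close>; the decoration \<open>d A\<close> of a ladder node depends on its fibre
  \<open>A = \<sigma>\<^sup>-\<^sup>1({j})\<close>. Each concatenation has at most one term, since \<open>\<sigma>\<close> is strictly increasing on
  both blocks.
\<close>

definition shuffle_tree ::
    "(nat set \<Rightarrow> 'a) \<Rightarrow> (nat \<Rightarrow> nat) \<Rightarrow> 'a ptree \<Rightarrow> 'a ptree \<Rightarrow> 'a ptree"
  where "shuffle_tree d \<sigma> t s =
    (let p = length (right_branch t); q = length (left_branch s); n = card (\<sigma> ` {1..p + q})
     in ladder
          (\<lambda>j. d {i \<in> {1..p + q}. \<sigma> i = j})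
          (\<lambda>j. concat [branch_forest t s i. i \<leftarrow> [1..<p + 1], \<sigma> i = j])
          (\<lambda>j. concat [branch_forest t s i. i \<leftarrow> [p + 1..<p + q + 1], \<sigma> i = j])
          1 (n - 1))"

definition sh_tree :: "(nat \<Rightarrow> nat) \<Rightarrow> 'a ptree \<Rightarrow> 'a ptree \<Rightarrow> 'a ptree"
  where "sh_tree \<sigma> t s = shuffle_tree (\<lambda>A. branch_dec t s (the_elem A)) \<sigma> t s"

text \<open>
  A fibre with two elements meets both blocks, so its minimum belongs to \<open>t\<close> and its maximum to
  \<open>s\<close>; the order matters since \<open>add\<close> need not be commutative.
\<close>

definition qsh_tree :: "('a \<Rightarrow> 'a \<Rightarrow> 'a) \<Rightarrow> (nat \<Rightarrow> nat) \<Rightarrow> 'a ptree \<Rightarrow> 'a ptree \<Rightarrow> 'a ptree"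
  where "qsh_tree add \<sigma> t s = shuffle_tree
    (\<lambda>A. if is_singleton A then branch_dec t s (the_elem A)
          else add (branch_dec t s (Min A)) (branch_dec t s (Max A))) \<sigma> t s"

end

theory Submission
  imports Defs
begin

text \<open>
  Sort the quasi-shuffles of a right branch with a left branch by the fibre over the root of the
  ladder: it is the root of \<open>t\<close>, the root of \<open>s\<close>, or both. These three families satisfy the
  recursions defining \<open><\<close>, \<open>>\<close> and \<open>\<bullet>\<close>, so the formula follows by induction on the
  number of vertices. The induction is carried out on words recording the fibres one by one,
  where removing the root is removing the first letter.
\<close>

section \<open>Linear extension of maps given on a basis\<close>

lemma lookup_lin_ext:
  "Poly_Mapping.lookup (lin_ext f v) c =
    (\<Sum>b \<in> Poly_Mapping.keys v. Poly_Mapping.lookup v b * Poly_Mapping.lookup (f b) c)"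
  unfolding lin_ext_def lookup_sum
  by (rule sum.cong) (auto simp: Poly_Mapping.map.rep_eq when_def in_keys_iff)

text \<open>The extra terms have coefficient zero. Since coefficients may cancel in
  \<open>u + v\<close>, additivity is proved by summing over the union of both supports.\<close>

lemma lookup_lin_ext_superset:
  assumes "finite K" and "Poly_Mapping.keys v \<subseteq> K"
  shows "Poly_Mapping.lookup (lin_ext f v) c =
    (\<Sum>b \<in> K. Poly_Mapping.lookup v b * Poly_Mapping.lookup (f b) c)"
  unfolding lookup_lin_ext using assms
  by (intro sum.mono_neutral_left) (auto simp: in_keys_iff)

lemma lin_ext_basis [simp]: "lin_ext f (basis b) = f b"
  by (rule poly_mapping_eqI) (simp add: lookup_lin_ext basis_def)

lemma lin_ext_zero [simp]: "lin_ext f 0 = 0"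
  by (simp add: lin_ext_def)

lemma lin_ext_add: "lin_ext f (u + v) = lin_ext f u + lin_ext f v"
proof (rule poly_mapping_eqI)
  fix c
  let ?K = "Poly_Mapping.keys u \<union> Poly_Mapping.keys v"
  have "Poly_Mapping.keys (u + v) \<subseteq> ?K"
    by (rule keys_add)
  then show "Poly_Mapping.lookup (lin_ext f (u + v)) c =
      Poly_Mapping.lookup (lin_ext f u + lin_ext f v) c"
    by (simp add: lookup_lin_ext_superset[of ?K] lookup_add distrib_right sum.distrib)
qed

lemma lin_ext_sum: "lin_ext f (\<Sum>w\<in>W. g w) = (\<Sum>w\<in>W. lin_ext f (g w))"
  by (induction W rule: infinite_finite_induct) (simp_all add: lin_ext_add)

section \<open>Words encoding quasi-shuffles\<close>

text \<open>
  A quasi-shuffle is encoded by the word whose \<open>j\<close>-th letter tells whether the fibre over \<open>j\<close>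
  meets the first and the second block; \<open>b\<close> says whether it may meet both.
\<close>

definition qwords :: "bool \<Rightarrow> nat \<Rightarrow> nat \<Rightarrow> (bool \<times> bool) list set"
  where "qwords b p q = {w. (False, False) \<notin> set w \<and> (\<not> b \<longrightarrow> (True, True) \<notin> set w) \<and>
    length (filter fst w) = p \<and> length (filter snd w) = q}"

lemma Nil_in_qwords [simp]: "[] \<in> qwords b p q \<longleftrightarrow> p = 0 \<and> q = 0"
  by (auto simp: qwords_def)

lemma Cons_in_qwords [simp]:
  "(False, False) # w \<notin> qwords b p q"
  "(True, False) # w \<in> qwords b p q \<longleftrightarrow> (\<exists>p'. p = Suc p' \<and> w \<in> qwords b p' q)"
  "(False, True) # w \<in> qwords b p q \<longleftrightarrow> (\<exists>q'. q = Suc q' \<and> w \<in> qwords b p q')"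
  "(True, True) # w \<in> qwords b p q \<longleftrightarrow>
    b \<and> (\<exists>p' q'. p = Suc p' \<and> q = Suc q' \<and> w \<in> qwords b p' q')"
  by (auto simp: qwords_def)

text \<open>Once one block is exhausted a single word remains, so sums over words collapse to one
  term. This is the counterpart of the clauses for a root without children.\<close>

lemma in_qwords_0_left [simp]: "w \<in> qwords b 0 q \<longleftrightarrow> w = replicate q (False, True)"
proof (induction w arbitrary: q)
  case (Cons a w)
  then show ?case by (cases a; cases "fst a"; cases "snd a"; cases q) auto
qed auto

lemma in_qwords_0_right [simp]: "w \<in> qwords b p 0 \<longleftrightarrow> w = replicate p (True, False)"
proof (induction w arbitrary: p)
  case (Cons a w)
  then show ?case by (cases a; cases "fst a"; cases "snd a"; cases p) auto
qed auto

lemma qwords_0 [simp]: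
  "qwords b 0 q = {replicate q (False, True)}" "qwords b p 0 = {replicate p (True, False)}"
  by auto

lemma qwords_Suc_Suc:
  "qwords b (Suc p) (Suc q) = (#) (True, False) ` qwords b p (Suc q) \<union>
    (#) (False, True) ` qwords b (Suc p) q \<union>
    (if b then (#) (True, True) ` qwords b p q else {})" (is "?L = ?R")
proof (rule set_eqI)
  fix w
  show "w \<in> ?L \<longleftrightarrow> w \<in> ?R"
  proof (cases w)
    case (Cons a v)
    then show ?thesis by (cases a; cases "fst a"; cases "snd a") auto
  qed auto
qed

lemma finite_qwords [simp]: "finite (qwords b p q)"
proof (induction "p + q" arbitrary: p q rule: less_induct)
  case less
  show ?case
  proof (cases p)
    case (Suc p')
    note p = this
    show ?thesis
    proof (cases q)
      case (Suc q')
      then show ?thesis using p less by (cases b) (simp_all add: qwords_Suc_Suc)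
    qed simp
  qed simp
qed

text \<open>The first letter is the fibre over the root of the ladder; the three sums will match
  \<open>tree_prec\<close>, \<open>tree_succ\<close> and \<open>tree_bullet\<close>, in this
  order.\<close>

lemma sum_qwords_Suc_Suc:
  "sum f (qwords b (Suc p) (Suc q)) =
    (\<Sum>w\<in>qwords b p (Suc q). f ((True, False) # w)) +
    (\<Sum>w\<in>qwords b (Suc p) q. f ((False, True) # w)) +
    (if b then (\<Sum>w\<in>qwords b p q. f ((True, True) # w)) else 0)"
proof -
  have disj: "(#) (True, False) ` X \<inter> (#) (False, True) ` Y = {}"
    "((#) (True, False) ` X \<union> (#) (False, True) ` Y) \<inter> (#) (True, True) ` Z = {}" for X Y Z
    by auto
  show ?thesis
    by (cases b) (simp_all add: qwords_Suc_Suc sum.union_disjoint disj sum.reindex)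
qed

section \<open>Trees built from words, and the products as sums over words\<close>

fun layers :: "('a \<Rightarrow> 'a \<Rightarrow> 'a) \<Rightarrow> (bool \<times> bool) list \<Rightarrow> ('a \<times> 'b list) list \<Rightarrow>
    ('a \<times> 'b list) list \<Rightarrow> ('a \<times> 'b list \<times> 'b list) list"
  where
    "layers add ((True, False) # w) ((x, F) # A) B = (x, F, []) # layers add w A B"
  | "layers add ((False, True) # w) A ((y, G) # B) = (y, [], G) # layers add w A B"
  | "layers add ((True, True) # w) ((x, F) # A) ((y, G) # B) = (add x y, F, G) # layers add w A B"
  | "layers add _ _ _ = []"

text \<open>The value is a forest with at most one tree: an exhausted list of layers contributes no
  child, so the leaf of the ladder needs no separate clause.\<close>

fun stack :: "('a \<times> 'a ptree list \<times> 'a ptree list) list \<Rightarrow> 'a ptree list"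
  where
    "stack [] = []"
  | "stack ((x, F, G) # ls) = [Node x (F @ stack ls @ G)]"

text \<open>A branch with its side forests determines the tree. This evaluates the sums in which the
  other branch is exhausted.\<close>

lemma stack_left_branch:
  "stack (layers add (replicate (length (left_branch T)) (False, True)) [] (left_branch T)) = [T]"
  by (induction T rule: left_branch.induct) auto

lemma stack_right_branch:
  "stack (layers add (replicate (length (right_branch S)) (True, False)) (right_branch S) []) = [S]"
  by (induction S rule: right_branch.induct) auto

text \<open>On words that fit the lengths of the branches, the catch-all clause of
  \<open>layers\<close> is reached only by the empty word.\<close>

lemma length_layers:
  "w \<in> qwords b (length A) (length B) \<Longrightarrow> length (layers add w A B) = length w"
  by (induction add w A B rule: layers.induct) (auto simp: Cons_replicate_eq)

definition word_tree ::
    "('a \<Rightarrow> 'a \<Rightarrow> 'a) \<Rightarrow> ('a \<times> 'a ptree list) list \<Rightarrow> ('a \<times> 'a ptree list) list \<Rightarrow>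
      (bool \<times> bool) list \<Rightarrow> 'a ptree"
  where "word_tree add A B w = hd (stack (layers add w A B))"

text \<open>A nonempty branch forces a nonempty word, hence a layer, so \<open>hd\<close> in
  \<open>word_tree\<close> picks the only tree of the forest.\<close>

lemma stack_layers:
  assumes "w \<in> qwords b (length A) (length B)" and "A \<noteq> [] \<or> B \<noteq> []"
  shows "stack (layers add w A B) = [word_tree add A B w]"
proof -
  have "layers add w A B \<noteq> []"
    using assms length_layers[OF assms(1), of add] by auto
  then show ?thesis
    by (cases "layers add w A B") (auto simp: word_tree_def)
qed

lemma right_branch_neq_Nil [simp]: "right_branch t \<noteq> []"
  by (cases t) simp

lemma left_branch_neq_Nil [simp]: "left_branch t \<noteq> []"
  by (cases t) simp

text \<open>One induction serves both products, with \<open>b\<close> switching the third summand.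
  Each half-product calls \<open>star\<close> on a pair of smaller total size, and cutting off a
  root shortens its branch by one entry, just as dropping the first letter shortens the
  word.\<close>

lemma star_eq_sum_qwords:
  fixes star :: "'a ptree \<Rightarrow> 'a ptree \<Rightarrow> ('a, 'k::field) ptree_space"
  assumes star: "\<And>S T. star S T = tree_prec star S T + tree_succ star S T +
      (if b then tree_bullet add star S T else 0)"
  shows "star S T = (\<Sum>w\<in>qwords b (length (right_branch S)) (length (left_branch T)).
      basis (word_tree add (right_branch S) (left_branch T) w))"
proof (induction "size S + size T" arbitrary: S T rule: less_induct)
  case less
  obtain x Ss where S: "S = Node x Ss" by (cases S)
  obtain y Ts where T: "T = Node y Ts" by (cases T)
  \<comment> \<open>\<open>A\<close> and \<open>B\<close> are the branches below the roots, empty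
    when the root has no children.\<close>
  define A where "A = (if Ss = [] then [] else right_branch (last Ss))"
  define B where "B = (if Ts = [] then [] else left_branch (hd Ts))"
  have AS: "right_branch S = (x, butlast Ss) # A" and BT: "left_branch T = (y, tl Ts) # B"
    by (auto simp: S T A_def B_def)
  have size_S: "size (last Ss) < size S" if "Ss \<noteq> []"
    using size_last_less[OF that] by (simp add: S)
  have size_T: "size (hd Ts) < size T" if "Ts \<noteq> []"
    using size_hd_less[OF that] by (simp add: T)
  \<comment> \<open>Writing \<open>stack\<close> instead of \<open>word_tree\<close> makes one
    formula cover both clauses: if \<open>S\<close> is a single vertex, the only word rebuilds
    \<open>T\<close>.\<close>
  have prec: "tree_prec star S T = (\<Sum>w\<in>qwords b (length A) (length (left_branch T)).
      basis (Node x (butlast Ss @ stack (layers add w A (left_branch T)))))"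
  proof (cases "Ss = []")
    case True
    then show ?thesis
      by (simp add: tree_prec_def S A_def stack_left_branch)
  next
    case False
    have "star (last Ss) T = (\<Sum>w\<in>qwords b (length A) (length (left_branch T)).
        basis (word_tree add A (left_branch T) w))"
      using less[of "last Ss" T] size_S[OF False] by (simp add: A_def False)
    then show ?thesis
      by (simp add: tree_prec_def S False lin_ext_sum stack_layers[where b = b])
  qed
  have succ: "tree_succ star S T = (\<Sum>w\<in>qwords b (length (right_branch S)) (length B).
      basis (Node y (stack (layers add w (right_branch S) B) @ tl Ts)))"
  proof (cases "Ts = []")
    case True
    then show ?thesis
      by (simp add: tree_succ_def T B_def stack_right_branch)
  next
    case False
    have "star S (hd Ts) = (\<Sum>w\<in>qwords b (length (right_branch S)) (length B).
        basis (word_tree add (right_branch S) B w))"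
      using less[of S "hd Ts"] size_T[OF False] by (simp add: B_def False)
    then show ?thesis
      by (simp add: tree_succ_def T False lin_ext_sum stack_layers[where b = b])
  qed
  \<comment> \<open>If exactly one root has no children, the only word rebuilds the missing last or
    first child of the other root; if both have none, \<open>stack\<close> is empty.\<close>
  have bullet: "tree_bullet add star S T = (\<Sum>w\<in>qwords b (length A) (length B).
      basis (Node (add x y) (butlast Ss @ stack (layers add w A B) @ tl Ts)))"
  proof (cases "Ss = [] \<or> Ts = []")
    case True
    have "tree_bullet add star S T = basis (Node (add x y) Ts)" if "Ss = []"
      using that by (simp add: tree_bullet_def S T)
    moreover have "tree_bullet add star S T = basis (Node (add x y) Ss)" if "Ts = []"
      using that by (simp add: tree_bullet_def S T)
    ultimately show ?thesis
      using True by (auto simp: A_def B_def stack_left_branch stack_right_branch)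
  next
    case False
    then have ne: "Ss \<noteq> []" "Ts \<noteq> []" by auto
    have "star (last Ss) (hd Ts) = (\<Sum>w\<in>qwords b (length A) (length B).
        basis (word_tree add A B w))"
      using less[of "last Ss" "hd Ts"] size_S[OF ne(1)] size_T[OF ne(2)]
      by (simp add: A_def B_def ne)
    moreover have "A \<noteq> []" by (simp add: A_def ne)
    ultimately show ?thesis
      by (simp add: tree_bullet_def S T ne lin_ext_sum stack_layers[where b = b])
  qed
  \<comment> \<open>The three formulas are sums over the words left after the first letter, so
    \<open>sum_qwords_Suc_Suc\<close> assembles them.\<close>
  show ?case
    unfolding star[of S T] prec succ bullet
    by (simp add: AS BT sum_qwords_Suc_Suc word_tree_def)
qed

section \<open>The bijection from words to quasi-shuffles\<close>

definition positions :: "('b \<Rightarrow> bool) \<Rightarrow> 'b list \<Rightarrow> nat list"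
  where "positions f w = map Suc (filter (\<lambda>m. f (w ! m)) [0..<length w])"

lemma sorted_positions: "sorted_wrt (<) (positions f w)"
  unfolding positions_def sorted_wrt_map
  by (simp add: sorted_wrt_filter)

lemma set_positions: "set (positions f w) = Suc ` {m. m < length w \<and> f (w ! m)}"
  by (auto simp: positions_def)

lemma length_positions: "length (positions f w) = length (filter f w)"
proof -
  have "filter f w = map ((!) w) (filter (f \<circ> (!) w) [0..<length w])"
    by (metis filter_map map_nth)
  then show ?thesis by (simp add: positions_def comp_def)
qed

text \<open>The index of an occurrence in the list is the number of earlier occurrences. Indices
  start at 0, whereas the entries of \<open>positions\<close> start at 1, like the nodes of the
  ladder.\<close>

lemma nth_positions:
  assumes "m < length w" and "f (w ! m)"
  shows "length (filter f (take m w)) < length (positions f w)"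
    and "positions f w ! length (filter f (take m w)) = Suc m"
proof -
  have up: "[0..<length w] = [0..<m] @ m # [Suc m..<length w]"
    using upt_add_eq_append[of 0 m "length w - m"] upt_conv_Cons[of m "length w"] assms(1) by simp
  have "filter (\<lambda>i. f (take m w ! i)) [0..<m] = filter (\<lambda>i. f (w ! i)) [0..<m]"
    by (rule filter_cong) auto
  then have "length (filter (\<lambda>i. f (w ! i)) [0..<m]) = length (filter f (take m w))"
    using length_positions[of f "take m w"] assms(1) by (simp add: positions_def)
  then have "length (filter f (take m w)) < length (positions f w) \<and>
      positions f w ! length (filter f (take m w)) = Suc m"
    unfolding positions_def up using assms(2) by (simp add: nth_append)
  then show "length (filter f (take m w)) < length (positions f w)"
    "positions f w ! length (filter f (take m w)) = Suc m" by auto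
qed

text \<open>Inverse of the encoding by fibres: the elements of a block go, in order, to the letters
  that meet this block.\<close>

definition word_qsh :: "nat \<Rightarrow> nat \<Rightarrow> (bool \<times> bool) list \<Rightarrow> nat \<Rightarrow> nat"
  where "word_qsh p q w = (\<lambda>i\<in>{1..p + q}.
    if i \<le> p then positions fst w ! (i - 1) else positions snd w ! (i - p - 1))"

lemma map_word_qsh:
  assumes "w \<in> qwords b p q"
  shows "map (word_qsh p q w) [1..<p + 1] = positions fst w"
    and "map (word_qsh p q w) [p + 1..<p + q + 1] = positions snd w"
  using assms
  by (auto intro!: nth_equalityI simp: qwords_def length_positions word_qsh_def simp del: upt_Suc)

lemma fst_or_snd_nth:
  assumes "w \<in> qwords b p q" and "m < length w"
  shows "fst (w ! m) \<or> snd (w ! m)"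
proof (rule ccontr)
  assume "\<not> (fst (w ! m) \<or> snd (w ! m))"
  then have "w ! m = (False, False)" by (simp add: prod_eq_iff)
  then show False
    using assms nth_mem[OF assms(2)] by (simp add: qwords_def)
qed

text \<open>Surjectivity onto the nodes comes from the absence of the letter
  \<open>(False, False)\<close>.\<close>

lemma image_word_qsh:
  assumes "w \<in> qwords b p q"
  shows "word_qsh p q w ` {1..p} = Suc ` {m. m < length w \<and> fst (w ! m)}"
    and "word_qsh p q w ` {p + 1..p + q} = Suc ` {m. m < length w \<and> snd (w ! m)}"
    and "word_qsh p q w ` {1..p + q} = {1..length w}"
proof -
  show 1: "word_qsh p q w ` {1..p} = Suc ` {m. m < length w \<and> fst (w ! m)}"
    using arg_cong[OF map_word_qsh(1)[OF assms], of set]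
    by (simp add: set_positions atLeastLessThanSuc_atLeastAtMost del: upt_Suc)
  show 2: "word_qsh p q w ` {p + 1..p + q} = Suc ` {m. m < length w \<and> snd (w ! m)}"
    using arg_cong[OF map_word_qsh(2)[OF assms], of set]
    by (simp add: set_positions atLeastLessThanSuc_atLeastAtMost del: upt_Suc)
  have "fst (w ! m) \<or> snd (w ! m)" if "m < length w" for m
    using fst_or_snd_nth[OF assms that] .
  then have "Suc ` {m. m < length w \<and> fst (w ! m)} \<union> Suc ` {m. m < length w \<and> snd (w ! m)}
      = Suc ` {m. m < length w}" by blast
  also have "\<dots> = {1..length w}"
    by (simp add: image_Suc_lessThan flip: lessThan_def)
  finally have "word_qsh p q w ` ({1..p} \<union> {p + 1..p + q}) = {1..length w}"
    unfolding 1[symmetric] 2[symmetric] image_Un[symmetric] .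
  moreover have "{1..p} \<union> {p + 1..p + q} = {1..p + q}" by auto
  ultimately show "word_qsh p q w ` {1..p + q} = {1..length w}" by simp
qed

text \<open>Monotonicity becomes sortedness of a list because a strictly increasing list is
  determined by its set of entries.\<close>

lemma strict_mono_on_iff_sorted_wrt:
  "strict_mono_on {a..c} f \<longleftrightarrow> sorted_wrt (<) (map f [a..<Suc c])" for f :: "nat \<Rightarrow> nat"
proof
  assume *: "strict_mono_on {a..c} f"
  have "f (a + i) < f (a + j)" if "i < j" "j < Suc c - a" for i j
    using that by (intro strict_mono_onD[OF *]) auto
  then show "sorted_wrt (<) (map f [a..<Suc c])"
    by (simp add: sorted_wrt_iff_nth_less del: upt_Suc)
next
  assume *: "sorted_wrt (<) (map f [a..<Suc c])"
  show "strict_mono_on {a..c} f"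
  proof (rule strict_mono_onI)
    fix r s assume "r \<in> {a..c}" "s \<in> {a..c}" "r < s"
    then show "f r < f s"
      using sorted_wrt_nth_less[OF *, of "r - a" "s - a"] by (simp del: upt_Suc)
  qed
qed

text \<open>The blocks must not both be empty: the empty word has image \<open>{1..0}\<close>, while
  \<open>QSh\<close> asks for \<open>n \<ge> 1\<close>.\<close>

lemma word_qsh_in_QSh:
  assumes w: "w \<in> qwords b p q" and "0 < p + q"
  shows "word_qsh p q w \<in> QSh p q"
proof -
  have "w \<noteq> []" using assms by auto
  then have "1 \<le> length w" by (cases w) auto
  moreover have "strict_mono_on {1..p} (word_qsh p q w)"
    using map_word_qsh(1)[OF w] sorted_positions[of fst w]
    by (simp add: strict_mono_on_iff_sorted_wrt del: upt_Suc)
  moreover have "strict_mono_on {p + 1..p + q} (word_qsh p q w)"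
    using map_word_qsh(2)[OF w] sorted_positions[of snd w]
    by (simp add: strict_mono_on_iff_sorted_wrt del: upt_Suc)
  moreover have "word_qsh p q w \<in> extensional {1..p + q}"
    by (simp add: word_qsh_def)
  ultimately show ?thesis
    unfolding QSh_def using image_word_qsh(3)[OF w] by blast
qed

text \<open>The full image gives the length of the word, and the images of the two blocks give the
  components of each letter.\<close>

lemma inj_on_word_qsh: "inj_on (word_qsh p q) (qwords b p q)"
proof (rule inj_onI)
  fix v w assume v: "v \<in> qwords b p q" and w: "w \<in> qwords b p q"
    and eq: "word_qsh p q v = word_qsh p q w"
  have len: "length v = length w"
    using image_word_qsh(3)[OF v] image_word_qsh(3)[OF w] eq
    by (metis card_atLeastAtMost diff_Suc_1)
  have "fst (v ! m) = fst (w ! m)" "snd (v ! m) = snd (w ! m)" if "m < length w" for m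
    using image_word_qsh(1,2)[OF v] image_word_qsh(1,2)[OF w] that
    by (auto simp: eq len set_eq_iff image_iff)
  then show "v = w"
    by (intro nth_equalityI) (auto simp: len prod_eq_iff)
qed

text \<open>A quasi-shuffle is strictly increasing on each block, hence determined by the images of
  the two blocks; these are what a word records.\<close>

lemma QSh_subset_word_qsh: "QSh p q \<subseteq> word_qsh p q ` qwords True p q"
proof
  fix \<sigma> assume "\<sigma> \<in> QSh p q"
  then obtain n where ext: "\<sigma> \<in> extensional {1..p + q}" and im: "\<sigma> ` {1..p + q} = {1..n}"
    and mono: "strict_mono_on {1..p} \<sigma>" "strict_mono_on {p + 1..p + q} \<sigma>"
    by (auto simp: QSh_def)
  \<comment> \<open>Letter \<open>m\<close> describes the fibre over node
    \<open>Suc m\<close>.\<close>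
  define w where
    "w = map (\<lambda>m. (Suc m \<in> \<sigma> ` {1..p}, Suc m \<in> \<sigma> ` {p + 1..p + q})) [0..<n]"
  have len: "length w = n"
    and nth: "m < n \<Longrightarrow> w ! m = (Suc m \<in> \<sigma> ` {1..p}, Suc m \<in> \<sigma> ` {p + 1..p + q})" for m
    by (auto simp: w_def)
  have un: "\<sigma> ` {1..p} \<union> \<sigma> ` {p + 1..p + q} = {1..n}"
    unfolding im[symmetric] image_Un[symmetric] by (rule arg_cong[where f = "image \<sigma>"]) auto
  have set_Suc: "Suc ` {m. m < n \<and> Suc m \<in> X} = X" if X: "X \<subseteq> {1..n}" for X
  proof (intro subset_antisym subsetI)
    fix x assume x: "x \<in> X"
    then have "x = Suc (x - 1)" "x - 1 < n" using X by force+
    then show "x \<in> Suc ` {m. m < n \<and> Suc m \<in> X}"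
      using x by (metis (mono_tags, lifting) image_eqI mem_Collect_eq)
  qed blast
  have "\<sigma> ` {1..p} \<subseteq> {1..n}" "\<sigma> ` {p + 1..p + q} \<subseteq> {1..n}"
    using un by blast+
  note set_Suc = this[THEN set_Suc]
  have "{m. m < n \<and> fst (w ! m)} = {m. m < n \<and> Suc m \<in> \<sigma> ` {1..p}}"
    "{m. m < n \<and> snd (w ! m)} = {m. m < n \<and> Suc m \<in> \<sigma> ` {p + 1..p + q}}"
    using nth by (metis (no_types, lifting) fst_conv, metis (no_types, lifting) snd_conv)
  then have set1: "set (positions fst w) = \<sigma> ` {1..p}"
    and set2: "set (positions snd w) = \<sigma> ` {p + 1..p + q}"
    unfolding set_positions len by (simp_all only: set_Suc)
  \<comment> \<open>Both lists are strictly increasing with the same entries, hence equal.\<close>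
  have pos1: "positions fst w = map \<sigma> [1..<Suc p]"
  proof (rule strict_sorted_equal)
    show "sorted_wrt (<) (map \<sigma> [1..<Suc p])"
      using mono(1) by (simp only: strict_mono_on_iff_sorted_wrt)
    show "set (positions fst w) = set (map \<sigma> [1..<Suc p])"
      unfolding set1 by (simp only: set_map set_upt atLeastLessThanSuc_atLeastAtMost)
  qed (rule sorted_positions)
  have pos2: "positions snd w = map \<sigma> [p + 1..<Suc (p + q)]"
  proof (rule strict_sorted_equal)
    show "sorted_wrt (<) (map \<sigma> [p + 1..<Suc (p + q)])"
      using mono(2) by (simp only: strict_mono_on_iff_sorted_wrt)
    show "set (positions snd w) = set (map \<sigma> [p + 1..<Suc (p + q)])"
      unfolding set2 by (simp only: set_map set_upt atLeastLessThanSuc_atLeastAtMost)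
  qed (rule sorted_positions)
  have "w ! m \<noteq> (False, False)" if "m < n" for m
  proof -
    have "Suc m \<in> \<sigma> ` {1..p} \<union> \<sigma> ` {p + 1..p + q}"
      unfolding un using that by simp
    then show ?thesis
      unfolding nth[OF that] by blast
  qed
  then have "(False, False) \<notin> set w"
    by (metis in_set_conv_nth len)
  moreover have "length (filter fst w) = p" "length (filter snd w) = q"
    unfolding length_positions[symmetric] pos1 pos2 by (simp_all del: upt_Suc)
  ultimately have w: "w \<in> qwords True p q"
    by (simp add: qwords_def)
  have "word_qsh p q w = \<sigma>"
  proof (rule extensionalityI[OF _ ext])
    show "word_qsh p q w i = \<sigma> i" if "i \<in> {1..p + q}" for i
      using that by (cases "i \<le> p") (auto simp: word_qsh_def pos1 pos2 simp del: upt_Suc)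
  qed (simp add: word_qsh_def)
  then show "\<sigma> \<in> word_qsh p q ` qwords True p q"
    using w by blast
qed

lemma bij_betw_word_qsh:
  "0 < p + q \<Longrightarrow> bij_betw (word_qsh p q) (qwords True p q) (QSh p q)"
  unfolding bij_betw_def using inj_on_word_qsh word_qsh_in_QSh QSh_subset_word_qsh by blast

text \<open>In a word without \<open>(False, False)\<close>, the sum \<open>p + q\<close> counts
  \<open>(True, True)\<close> twice and every other letter once.\<close>

lemma in_qwords_False_iff:
  "w \<in> qwords False p q \<longleftrightarrow> w \<in> qwords True p q \<and> length w = p + q"
proof -
  have "length (filter fst w) + length (filter snd w) =
      length w + length (filter (\<lambda>a. a = (True, True)) w)" if "(False, False) \<notin> set w"
    using that by (induction w) auto
  then show ?thesis
    by (auto simp: qwords_def filter_empty_conv)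
qed

lemma bij_betw_word_sh:
  assumes "0 < p + q"
  shows "bij_betw (word_qsh p q) (qwords False p q) (Sh p q)"
proof -
  have iff: "word_qsh p q w \<in> Sh p q \<longleftrightarrow> w \<in> qwords False p q" if w: "w \<in> qwords True p q" for w
  proof -
    \<comment> \<open>The image has \<open>length w\<close> points, so injectivity on
      \<open>p + q\<close> arguments is equality of cardinalities.\<close>
    have "(\<exists>n. bij_betw (word_qsh p q w) {1..p + q} {1..n}) \<longleftrightarrow> length w = p + q"
    proof
      assume "\<exists>n. bij_betw (word_qsh p q w) {1..p + q} {1..n}"
      then have "card (word_qsh p q w ` {1..p + q}) = p + q"
        by (auto simp: bij_betw_def card_image)
      then show "length w = p + q"
        by (simp only: image_word_qsh(3)[OF w] card_atLeastAtMost diff_Suc_1)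
    next
      assume "length w = p + q"
      then have "bij_betw (word_qsh p q w) {1..p + q} {1..length w}"
        unfolding bij_betw_def
        by (intro conjI eq_card_imp_inj_on) (simp_all only: image_word_qsh(3)[OF w]
          card_atLeastAtMost diff_Suc_1 finite_atLeastAtMost)
      then show "\<exists>n. bij_betw (word_qsh p q w) {1..p + q} {1..n}" by blast
    qed
    then show ?thesis
      using w word_qsh_in_QSh[OF w assms] by (simp add: Sh_def in_qwords_False_iff)
  qed
  have "word_qsh p q ` qwords False p q = Sh p q"
  proof
    show "word_qsh p q ` qwords False p q \<subseteq> Sh p q"
      using iff by (auto simp: in_qwords_False_iff)
    show "Sh p q \<subseteq> word_qsh p q ` qwords False p q"
    proof
      fix \<sigma> assume "\<sigma> \<in> Sh p q"
      moreover from this obtain w where "w \<in> qwords True p q" "\<sigma> = word_qsh p q w"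
        using QSh_subset_word_qsh[of p q] by (auto simp: Sh_def)
      ultimately show "\<sigma> \<in> word_qsh p q ` qwords False p q"
        using iff by blast
    qed
  qed
  then show ?thesis
    by (simp add: bij_betw_def inj_on_word_qsh)
qed

section \<open>Identification of the tree of a word with the tree
  \<open>\<sigma>(t,s)\<close>\<close>

lemma ladder_eq_stack:
  "[ladder d L R j m] = stack (map (\<lambda>i. (d i, L i, R i)) [j..<Suc (j + m)])"
proof (induction m arbitrary: j)
  case (Suc m)
  have "[j..<Suc (j + Suc m)] = j # [Suc j..<Suc (Suc j + m)]"
    by (subst upt_conv_Cons) auto
  then show ?case
    by (simp only: list.map stack.simps Suc[symmetric] ladder.simps)
qed simp

text \<open>The number of earlier letters meeting a block tells how much of its branch has been
  consumed. The entries \<open>a\<close> and \<open>c\<close> are read only if the current letter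
  meets their block, where the index is in range.\<close>

lemma nth_layers:
  assumes "w \<in> qwords b (length A) (length B)" and "m < length w"
  shows "layers add w A B ! m =
    (let a = A ! length (filter fst (take m w)); c = B ! length (filter snd (take m w)) in
      (if fst (w ! m) then if snd (w ! m) then add (fst a) (fst c) else fst a else fst c,
       if fst (w ! m) then snd a else [], if snd (w ! m) then snd c else []))"
  using assms
proof (induction add w A B arbitrary: m rule: layers.induct)
qed (auto simp: nth_Cons' take_Cons' Let_def Cons_replicate_eq)

text \<open>The list \<open>positions\<close> is distinct, so a node has at most one preimage in
  each block, located by counting earlier letters.\<close>

lemma fibre_word_qsh:
  assumes w: "w \<in> qwords b p q" and m: "m < length w"
  shows "{i \<in> {1..p}. word_qsh p q w i = Suc m} =
      (if fst (w ! m) then {Suc (length (filter fst (take m w)))} else {})" (is ?fst)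
    and "{i \<in> {p + 1..p + q}. word_qsh p q w i = Suc m} =
      (if snd (w ! m) then {Suc (p + length (filter snd (take m w)))} else {})" (is ?snd)
proof -
  have len: "length (positions fst w) = p" "length (positions snd w) = q"
    using w by (auto simp: qwords_def length_positions)
  have dist: "distinct (positions f w)" for f
    using sorted_positions[of f w] by (simp add: strict_sorted_iff)
  have notin: "Suc m \<notin> set (positions f w)" if "\<not> f (w ! m)" for f
    using that by (auto simp: set_positions)
  have key: "k < length (positions f w) \<and> positions f w ! k = Suc m \<longleftrightarrow>
      f (w ! m) \<and> k = length (filter f (take m w))" for f k
    using nth_positions[OF m, of f] notin[of f] nth_eq_iff_index_eq[OF dist[of f]]
    by (metis nth_mem)
  have "i \<in> {1..p} \<and> word_qsh p q w i = Suc m \<longleftrightarrow>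
      fst (w ! m) \<and> i = Suc (length (filter fst (take m w)))" for i
    using key[of "i - 1" fst] nth_positions(1)[of m w fst] m len
    by (cases i) (auto simp: word_qsh_def)
  then show ?fst by auto
  have "i \<in> {p + 1..p + q} \<and> word_qsh p q w i = Suc m \<longleftrightarrow>
      snd (w ! m) \<and> i = Suc (p + length (filter snd (take m w)))" for i
    using key[of "i - p - 1" snd] nth_positions(1)[of m w snd] m len
    by (cases "i \<le> p") (auto simp: word_qsh_def)
  then show ?snd by auto
qed

text \<open>Treats the two possibilities for a fibre inside one block, so each concatenation in
  \<open>shuffle_tree\<close> is empty or a single forest.\<close>

lemma concat_fibre:
  "{i \<in> {a..c}. P i} = {} \<Longrightarrow> concat [f i. i \<leftarrow> [a..<c + 1], P i] = []"
  "{i \<in> {a..c}. P i} = {k} \<Longrightarrow> concat [f i. i \<leftarrow> [a..<c + 1], P i] = f k"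
proof -
  have *: "concat [f i. i \<leftarrow> xs, P i] = concat (map f (filter P xs))" for xs
    by (induction xs) auto
  have set: "set (filter P [a..<c + 1]) = {i \<in> {a..c}. P i}"
    by auto
  show "concat [f i. i \<leftarrow> [a..<c + 1], P i] = []" if "{i \<in> {a..c}. P i} = {}"
    using set unfolding * that by (simp del: upt_Suc)
  show "concat [f i. i \<leftarrow> [a..<c + 1], P i] = f k" if "{i \<in> {a..c}. P i} = {k}"
  proof -
    have "filter P [a..<c + 1] = [k]"
      by (rule strict_sorted_equal) (use set that in \<open>simp_all add: sorted_wrt_filter del: upt_Suc\<close>)
    then show ?thesis unfolding * by simp
  qed
qed

text \<open>Keeping the fibre decoration \<open>d\<close> abstract covers \<open>sh_tree\<close> and
  \<open>qsh_tree\<close> together; its value on two-element fibres is prescribed when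
  \<open>b\<close> admits letters meeting both blocks.\<close>

lemma shuffle_tree_word_qsh:
  fixes t s :: "'a ptree"
  defines "p \<equiv> length (right_branch t)" and "q \<equiv> length (left_branch s)"
  assumes w: "w \<in> qwords b p q"
    and d1: "\<And>i. d {i} = branch_dec t s i"
    and d2: "\<And>i r. b \<Longrightarrow> i < r \<Longrightarrow> d {i, r} = add (branch_dec t s i) (branch_dec t s r)"
  shows "shuffle_tree d (word_qsh p q w) t s = word_tree add (right_branch t) (left_branch s) w"
proof -
  let ?\<sigma> = "word_qsh p q w"
  let ?A = "right_branch t" and ?B = "left_branch s"
  let ?L = "\<lambda>j. concat [branch_forest t s i. i \<leftarrow> [1..<p + 1], ?\<sigma> i = j]"
  let ?R = "\<lambda>j. concat [branch_forest t s i. i \<leftarrow> [p + 1..<p + q + 1], ?\<sigma> i = j]"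
  let ?d = "\<lambda>j. d {i \<in> {1..p + q}. ?\<sigma> i = j}"
  have w': "w \<in> qwords b (length ?A) (length ?B)"
    using w by (simp add: p_def q_def)
  have "p \<noteq> 0" by (simp add: p_def)
  then have "w \<noteq> []" using w by auto
  \<comment> \<open>Nodes are numbered from 1 and letters from 0, so node \<open>Suc m\<close> is
    compared with layer \<open>m\<close>.\<close>
  have "(?d (Suc m), ?L (Suc m), ?R (Suc m)) = layers add w ?A ?B ! m" if m: "m < length w" for m
  proof -
    let ?a = "length (filter fst (take m w))" and ?c = "length (filter snd (take m w))"
    have a: "?a < p" if "fst (w ! m)"
      using nth_positions(1)[of m w fst, OF m that] w by (simp add: length_positions qwords_def)
    have dec: "branch_dec t s (Suc ?a) = fst (?A ! ?a)" "branch_forest t s (Suc ?a) = snd (?A ! ?a)"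
      if "fst (w ! m)"
      using a[OF that] by (simp_all add: branch_dec_def branch_forest_def nth_append p_def)
    have dec': "branch_dec t s (Suc (p + ?c)) = fst (?B ! ?c)"
      "branch_forest t s (Suc (p + ?c)) = snd (?B ! ?c)"
      by (simp_all add: branch_dec_def branch_forest_def nth_append p_def)
    note fib = fibre_word_qsh[OF w m]
    have L: "?L (Suc m) = (if fst (w ! m) then snd (?A ! ?a) else [])"
    proof (cases "fst (w ! m)")
      case True
      then have "{i \<in> {1..p}. ?\<sigma> i = Suc m} = {Suc ?a}"
        using fib(1) by (simp only: if_True)
      from concat_fibre(2)[OF this, of "branch_forest t s"] show ?thesis
        using True dec by (simp only: if_True)
    next
      case False
      then have "{i \<in> {1..p}. ?\<sigma> i = Suc m} = {}"
        using fib(1) by (simp only: if_False)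
      from concat_fibre(1)[OF this, of "branch_forest t s"] show ?thesis
        using False by (simp only: if_False)
    qed
    have R: "?R (Suc m) = (if snd (w ! m) then snd (?B ! ?c) else [])"
    proof (cases "snd (w ! m)")
      case True
      then have "{i \<in> {p + 1..p + q}. ?\<sigma> i = Suc m} = {Suc (p + ?c)}"
        using fib(2) by (simp only: if_True)
      from concat_fibre(2)[OF this, of "branch_forest t s"] show ?thesis
        using True dec' by (simp only: if_True)
    next
      case False
      then have "{i \<in> {p + 1..p + q}. ?\<sigma> i = Suc m} = {}"
        using fib(2) by (simp only: if_False)
      from concat_fibre(1)[OF this, of "branch_forest t s"] show ?thesis
        using False by (simp only: if_False)
    qed
    have split: "{i \<in> {1..p + q}. ?\<sigma> i = Suc m} =
        {i \<in> {1..p}. ?\<sigma> i = Suc m} \<union> {i \<in> {p + 1..p + q}. ?\<sigma> i = Suc m}"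
      by auto
    have mem: "w ! m \<in> set w" using m by simp
    have ne: "fst (w ! m) \<or> snd (w ! m)"
      using fst_or_snd_nth[OF w m] .
    have both: b if "fst (w ! m)" "snd (w ! m)"
    proof -
      have "w ! m = (True, True)" using that by (simp add: prod_eq_iff)
      then show b using w mem by (auto simp: qwords_def)
    qed
    have D: "?d (Suc m) = (if fst (w ! m) then if snd (w ! m)
        then add (fst (?A ! ?a)) (fst (?B ! ?c)) else fst (?A ! ?a) else fst (?B ! ?c))"
    proof (cases "fst (w ! m) \<and> snd (w ! m)")
      case True
      then have "?d (Suc m) = d {Suc ?a, Suc (p + ?c)}"
        unfolding split fib by (simp add: insert_commute)
      then show ?thesis
        \<comment> \<open>The bound \<open>?a < p\<close> places the index from \<open>t\<close>
          before the one from \<open>s\<close>, which fixes the order of the arguments of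
          \<open>add\<close>.\<close>
        using True d2[of "Suc ?a" "Suc (p + ?c)"] both a by (simp add: dec dec')
    next
      case False
      then show ?thesis
        unfolding split fib using ne by (auto simp: d1 dec dec')
    qed
    show ?thesis
      unfolding nth_layers[OF w' m] Let_def L R D by simp
  qed
  then have layers: "map (\<lambda>j. (?d j, ?L j, ?R j)) [1..<Suc (length w)] = layers add w ?A ?B"
    by (intro nth_equalityI) (simp_all add: length_layers[OF w'] del: upt_Suc)
  have "shuffle_tree d ?\<sigma> t s = ladder ?d ?L ?R 1 (length w - 1)"
    unfolding shuffle_tree_def Let_def p_def[symmetric] q_def[symmetric]
      image_word_qsh(3)[OF w] by simp
  also have "\<dots> = hd [ladder ?d ?L ?R 1 (length w - 1)]" by simp
  also have "\<dots> = word_tree add ?A ?B w"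
    \<comment> \<open>The last argument of \<open>ladder\<close> is one less than the number of
      nodes; \<open>w \<noteq> []\<close> makes the subtraction exact.\<close>
    unfolding ladder_eq_stack word_tree_def layers[symmetric] using \<open>w \<noteq> []\<close> by simp
  finally show ?thesis .
qed

theorem theorem24:
  fixes t s :: "'a ptree"
    and add :: "'a \<Rightarrow> 'a \<Rightarrow> 'a"
    and k l :: nat
  assumes "length (right_branch t) = k + 1"
    and "length (left_branch s) = l + 1"
  shows "(shT (basis t) (basis s) :: ('a, 'k::field) ptree_space) =
           (\<Sum>\<sigma> \<in> Sh (k + 1) (l + 1). basis (sh_tree \<sigma> t s))
       \<and> (semigroup add \<longrightarrow>
           (qshT add (basis t) (basis s) :: ('a, 'k) ptree_space) =
             (\<Sum>\<sigma> \<in> QSh (k + 1) (l + 1). basis (qsh_tree add \<sigma> t s)))"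
proof (intro conjI impI)
  let ?p = "k + 1" and ?q = "l + 1"
  \<comment> \<open>One term serves both formulas: along words of \<open>qwords False\<close> every
    layer takes its decoration from a single branch node.\<close>
  let ?tree = "word_tree add (right_branch t) (left_branch s)"
  note len = assms[symmetric]
  have sh: "sh_tree (word_qsh ?p ?q w) t s = ?tree w" if "w \<in> qwords False ?p ?q" for w
    unfolding sh_tree_def len
    by (rule shuffle_tree_word_qsh[where b = False]) (use that assms in simp_all)
  have "shT (basis t) (basis s) = (sh_basis t s :: ('a, 'k) ptree_space)"
    by (simp add: shT_def bilin_ext_def)
  also have "\<dots> = (\<Sum>w\<in>qwords False ?p ?q. basis (?tree w))"
    \<comment> \<open>With \<open>b\<close> false the third summand is \<open>0\<close>, which
      leaves the defining equation of \<open>sh_basis\<close>.\<close>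
    unfolding len by (rule star_eq_sum_qwords) (simp only: if_False add_0_right, rule sh_basis.simps)
  also have "\<dots> = (\<Sum>w\<in>qwords False ?p ?q. basis (sh_tree (word_qsh ?p ?q w) t s))"
    by (rule sum.cong) (use sh in simp_all)
  also have "\<dots> = (\<Sum>\<sigma>\<in>Sh ?p ?q. basis (sh_tree \<sigma> t s))"
    by (rule sum.reindex_bij_betw[OF bij_betw_word_sh]) simp
  finally show "(shT (basis t) (basis s) :: ('a, 'k) ptree_space) =
      (\<Sum>\<sigma>\<in>Sh ?p ?q. basis (sh_tree \<sigma> t s))" .
  have qsh: "qsh_tree add (word_qsh ?p ?q w) t s = ?tree w" if "w \<in> qwords True ?p ?q" for w
    unfolding qsh_tree_def len
    \<comment> \<open>A fibre \<open>{i, r}\<close> with \<open>i < r\<close> is not a singleton and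
      has minimum \<open>i\<close> and maximum \<open>r\<close>.\<close>
    by (rule shuffle_tree_word_qsh[where b = True])
      (use that assms in \<open>auto simp: is_singleton_def\<close>)
  have "qshT add (basis t) (basis s) = (qsh_basis add t s :: ('a, 'k) ptree_space)"
    by (simp add: qshT_def bilin_ext_def)
  also have "\<dots> = (\<Sum>w\<in>qwords True ?p ?q. basis (?tree w))"
    unfolding len by (rule star_eq_sum_qwords) (simp only: if_True, rule qsh_basis.simps)
  also have "\<dots> = (\<Sum>w\<in>qwords True ?p ?q. basis (qsh_tree add (word_qsh ?p ?q w) t s))"
    by (rule sum.cong) (use qsh in simp_all)
  also have "\<dots> = (\<Sum>\<sigma>\<in>QSh ?p ?q. basis (qsh_tree add \<sigma> t s))"
    by (rule sum.reindex_bij_betw[OF bij_betw_word_qsh]) simp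
  finally show "(qshT add (basis t) (basis s) :: ('a, 'k) ptree_space) =
      (\<Sum>\<sigma>\<in>QSh ?p ?q. basis (qsh_tree add \<sigma> t s))" .
qed

end
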